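(* Every $P$-symmetric ring is weakly reversible.
   Context: Rings are associative with identity (not necessarily commutative). $P(R)$ denotes the prime radical of a ring $R$ (the intersection of all prime two-sided ideals of $R$). A ring $R$ is $P$-symmetric if for any $a,b,c\in R$, $abc=0$ implies $bac\in P(R)$. A ring $R$ is weakly reversible if for any $a,b,r\in R$, $ab=0$ implies that $Rbra$ is a nil left ideal of $R$ (that is, every element of the left ideal $Rbra$ is nilpotent). *)

theory Defs
  imports "HOL-Algebra.Ideal_Product"
begin

text \<open>
  HOL-Algebra's \<^locale>\<open>primeideal\<close> requires a commutative ring and is elementwise, hence the
  following definition for two-sided ideals of an arbitrary ring.
\<close>

definition nc_prime_ideal :: "'a set \<Rightarrow> ('a, 'b) ring_scheme \<Rightarrow> bool" where
  "nc_prime_ideal Q R \<longleftrightarrow>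
     ideal Q R \<and> Q \<noteq> carrier R \<and>
     (\<forall>I J. ideal I R \<longrightarrow> ideal J R \<longrightarrow> ideal_prod R I J \<subseteq> Q \<longrightarrow> I \<subseteq> Q \<or> J \<subseteq> Q)"

text \<open>
  The intersection is taken inside the carrier, so that an empty family of prime ideals
  (which happens only for the zero ring) yields the whole ring.
\<close>

definition prime_radical :: "('a, 'b) ring_scheme \<Rightarrow> 'a set" where
  "prime_radical R = carrier R \<inter> \<Inter>{Q. nc_prime_ideal Q R}"

definition P_symmetric :: "('a, 'b) ring_scheme \<Rightarrow> bool" where
  "P_symmetric R \<longleftrightarrow>
     (\<forall>a \<in> carrier R. \<forall>b \<in> carrier R. \<forall>c \<in> carrier R.
        a \<otimes>\<^bsub>R\<^esub> b \<otimes>\<^bsub>R\<^esub> c = \<zero>\<^bsub>R\<^esub> \<longrightarrow> b \<otimes>\<^bsub>R\<^esub> a \<otimes>\<^bsub>R\<^esub> c \<in> prime_radical R)"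

definition nilpotent_element :: "('a, 'b) ring_scheme \<Rightarrow> 'a \<Rightarrow> bool" where
  "nilpotent_element R x \<longleftrightarrow> (\<exists>n::nat. n > 0 \<and> x [^]\<^bsub>R\<^esub> n = \<zero>\<^bsub>R\<^esub>)"

definition left_ideal :: "'a set \<Rightarrow> ('a, 'b) ring_scheme \<Rightarrow> bool" where
  "left_ideal L R \<longleftrightarrow>
     additive_subgroup L R \<and> (\<forall>r \<in> carrier R. \<forall>x \<in> L. r \<otimes>\<^bsub>R\<^esub> x \<in> L)"

definition nil_left_ideal :: "'a set \<Rightarrow> ('a, 'b) ring_scheme \<Rightarrow> bool" where
  "nil_left_ideal L R \<longleftrightarrow> left_ideal L R \<and> (\<forall>x \<in> L. nilpotent_element R x)"

text \<open>
  The set \<open>R b r a\<close> is the multiplicative right coset of the carrier by \<open>b r a\<close>,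
  i.e. the set of all \<open>x (b r a)\<close> with \<open>x\<close> in \<open>R\<close>.
\<close>

definition weakly_reversible :: "('a, 'b) ring_scheme \<Rightarrow> bool" where
  "weakly_reversible R \<longleftrightarrow>
     (\<forall>a \<in> carrier R. \<forall>b \<in> carrier R. \<forall>r \<in> carrier R.
        a \<otimes>\<^bsub>R\<^esub> b = \<zero>\<^bsub>R\<^esub> \<longrightarrow>
        nil_left_ideal (carrier R #>\<^bsub>R\<^esub> (b \<otimes>\<^bsub>R\<^esub> r \<otimes>\<^bsub>R\<^esub> a)) R)"

end

theory Submission
  imports Defs "HOL-Algebra.Ring_Divisibility"
begin

text \<open>
  If \<open>ab = 0\<close> then \<open>(ra) \<cdot> b \<cdot> 1 = 0\<close>, so \<open>P\<close>-symmetry gives \<open>bra = b \<cdot> (ra) \<cdot> 1 \<in> P(R)\<close>, hence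
  \<open>R bra \<subseteq> P(R)\<close>. The prime radical is nil: an ideal maximal among those avoiding all powers of
  a non-nilpotent element is prime.
\<close>

context ring
begin

text \<open>Expand (p + i)(q + j) with p, q in \<open>Q\<close>: every term except ij has a factor
  in the two-sided ideal \<open>Q\<close>, and ij lies in the product of \<open>I\<close> and
  \<open>J\<close>. This is the computation behind primeness of a maximal ideal avoiding
  powers.\<close>

lemma mult_add_ideals_subset:
  assumes "ideal Q R" "ideal I R" "ideal J R" "ideal_prod R I J \<subseteq> Q"
    and "u \<in> Q <+>\<^bsub>R\<^esub> I" "v \<in> Q <+>\<^bsub>R\<^esub> J"
  shows "u \<otimes> v \<in> Q"
proof -
  interpret Q: ideal Q R by fact
  interpret I: ideal I R by fact
  interpret J: ideal J R by fact
  obtain p i where p: "p \<in> Q" "i \<in> I" and u: "u = p \<oplus> i"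
    using assms(5) by (auto simp: set_add_def')
  obtain q j where q: "q \<in> Q" "j \<in> J" and v: "v = q \<oplus> j"
    using assms(6) by (auto simp: set_add_def')
  have [simp]: "p \<in> carrier R" "i \<in> carrier R" "q \<in> carrier R" "j \<in> carrier R"
    using p q Q.Icarr I.Icarr J.Icarr by blast+
  have "i \<otimes> j \<in> Q"
    by (rule subsetD[OF assms(4) ideal_prod.prod[OF p(2) q(2)]])
  moreover have "p \<otimes> (q \<oplus> j) \<in> Q"
    by (rule Q.I_r_closed) (use p in simp_all)
  moreover have "i \<otimes> q \<in> Q"
    by (rule Q.I_l_closed) (use q in simp_all)
  ultimately have "p \<otimes> (q \<oplus> j) \<oplus> (i \<otimes> q \<oplus> i \<otimes> j) \<in> Q"
    by (intro Q.a_closed)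
  moreover have "u \<otimes> v = p \<otimes> (q \<oplus> j) \<oplus> (i \<otimes> q \<oplus> i \<otimes> j)"
    unfolding u v by (simp add: l_distr r_distr a_ac)
  ultimately show ?thesis by simp
qed

text \<open>Noncommutative form of the Krull argument: Zorn's lemma applies to the ideals disjoint
  from the powers of \<open>x\<close>, and these powers are closed under multiplication, which
  forces a maximal such ideal to be prime.\<close>

lemma nc_prime_ideal_avoiding_powers:
  assumes x: "x \<in> carrier R" and nz: "\<And>n::nat. x [^] n \<noteq> \<zero>"
  obtains Q where "nc_prime_ideal Q R" "x \<notin> Q"
proof -
  define S where "S = range (\<lambda>n::nat. x [^] n)"
  define \<A> where "\<A> = {I. ideal I R \<and> I \<inter> S = {}}"
  \<comment> \<open>Non-nilpotency of \<open>x\<close> enters only here: it makes the family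
    nonempty.\<close>
  have zero: "{\<zero>} \<in> \<A>"
    using zeroideal nz by (fastforce simp: \<A>_def S_def)
  have "\<exists>Q\<in>\<A>. \<forall>I\<in>\<A>. Q \<subseteq> I \<longrightarrow> I = Q"
  proof (rule subset_Zorn_nonempty)
    show "\<A> \<noteq> {}" using zero by blast
    fix C assume "C \<noteq> {}" and C: "subset.chain \<A> C"
    have "subset.chain {I. ideal I R} C"
      using C by (auto simp: pred_on.chain_def \<A>_def)
    then have "ideal (\<Union>C) R"
      using chain_Union_is_ideal[of C] \<open>C \<noteq> {}\<close> by simp
    moreover have "\<Union>C \<inter> S = {}"
      using C by (auto simp: pred_on.chain_def \<A>_def)
    ultimately show "\<Union>C \<in> \<A>" by (simp add: \<A>_def)
  qed
  then obtain Q where "Q \<in> \<A>" and max: "\<And>I. I \<in> \<A> \<Longrightarrow> Q \<subseteq> I \<Longrightarrow> I = Q"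
    by blast
  then have Q: "ideal Q R" and QS: "Q \<inter> S = {}"
    by (auto simp: \<A>_def)
  interpret Q: ideal Q R by (rule Q)
  \<comment> \<open>The sum of \<open>Q\<close> and \<open>I\<close> is an ideal strictly larger
    than \<open>Q\<close>, so by maximality it leaves the family, and it can do so only by
    containing a power of \<open>x\<close>.\<close>
  have meets: "\<exists>n::nat. x [^] n \<in> Q <+>\<^bsub>R\<^esub> I" if I: "ideal I R" "\<not> I \<subseteq> Q" for I
  proof -
    interpret I: ideal I R by (rule I)
    have add_mem: "q \<oplus> i \<in> Q <+>\<^bsub>R\<^esub> I" if "q \<in> Q" "i \<in> I" for q i
      using that by (auto simp: set_add_def')
    have "Q \<subseteq> Q <+>\<^bsub>R\<^esub> I"
      using add_mem[OF _ I.zero_closed] by (metis Q.Icarr r_zero subsetI)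
    moreover have "I \<subseteq> Q <+>\<^bsub>R\<^esub> I"
      using add_mem[OF Q.zero_closed] by (metis I.Icarr l_zero subsetI)
    ultimately have "Q <+>\<^bsub>R\<^esub> I \<notin> \<A>" using max I(2) by blast
    then show ?thesis
      using add_ideals[OF Q I(1)] by (auto simp: \<A>_def S_def)
  qed
  have "I \<subseteq> Q \<or> J \<subseteq> Q" if IJ: "ideal I R" "ideal J R" "ideal_prod R I J \<subseteq> Q" for I J
  proof (rule ccontr)
    assume "\<not> (I \<subseteq> Q \<or> J \<subseteq> Q)"
    then obtain m n :: nat where "x [^] m \<in> Q <+>\<^bsub>R\<^esub> I" "x [^] n \<in> Q <+>\<^bsub>R\<^esub> J"
      using meets IJ by meson
    \<comment> \<open>The product of the two powers is again a power of \<open>x\<close>, but it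
      falls into \<open>Q\<close>.\<close>
    then have "x [^] (m + n) \<in> Q"
      using mult_add_ideals_subset[OF Q IJ] x by (simp flip: nat_pow_mult)
    then show False using QS by (auto simp: S_def)
  qed
  \<comment> \<open>Exponent 1 gives that \<open>x\<close> is outside \<open>Q\<close>, which also
    makes \<open>Q\<close> proper.\<close>
  moreover have "x [^] (1::nat) \<notin> Q"
    using QS unfolding S_def by blast
  ultimately have "nc_prime_ideal Q R" "x \<notin> Q"
    using Q x by (auto simp: nc_prime_ideal_def)
  then show thesis by (rule that)
qed

lemma prime_radical_nil:
  assumes "x \<in> prime_radical R"
  shows "nilpotent_element R x"
proof -
  have x: "x \<in> carrier R" using assms by (simp add: prime_radical_def)
  obtain n :: nat where "x [^] n = \<zero>"
    using nc_prime_ideal_avoiding_powers[OF x] assms by (auto simp: prime_radical_def)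
  \<comment> \<open>The exponent found may be 0, while \<open>nilpotent_element\<close> asks for a
    positive one.\<close>
  then have "x [^] Suc n = \<zero>" using x by simp
  then show ?thesis unfolding nilpotent_element_def by blast
qed

lemma prime_radical_mult_left:
  assumes "s \<in> carrier R" "x \<in> prime_radical R"
  shows "s \<otimes> x \<in> prime_radical R"
  using assms by (auto simp: prime_radical_def nc_prime_ideal_def intro: ideal.I_l_closed)

lemma left_ideal_r_coset:
  assumes y: "y \<in> carrier R"
  shows "left_ideal (carrier R #> y) R"
  unfolding left_ideal_def
proof (intro conjI ballI)
  have "subgroup (carrier R #> y) (add_monoid R)"
  proof (rule add.subgroupI)
    show "carrier R #> y \<subseteq> carrier R" using y by (auto simp: r_coset_def)
    show "carrier R #> y \<noteq> {}" by (auto simp: r_coset_def)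
    \<comment> \<open>Here and below, the reversed ring laws pull \<open>y\<close> out on the right,
      which exhibits the result as a left multiple of \<open>y\<close>.\<close>
    show "\<ominus> u \<in> carrier R #> y" if "u \<in> carrier R #> y" for u
      using that y by (auto simp: r_coset_def simp flip: l_minus)
    show "u \<oplus> v \<in> carrier R #> y" if "u \<in> carrier R #> y" "v \<in> carrier R #> y" for u v
      using that y by (auto simp: r_coset_def simp flip: l_distr)
  qed
  then show "additive_subgroup (carrier R #> y) R" by (rule additive_subgroup.intro)
  show "r \<otimes> u \<in> carrier R #> y" if "r \<in> carrier R" "u \<in> carrier R #> y" for r u
    using that y by (auto simp: r_coset_def simp flip: m_assoc)
qed

end

theorem proposition2p10:
  fixes R :: "('a, 'b) ring_scheme"
  assumes "ring R" and "P_symmetric R"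
  shows "weakly_reversible R"
  unfolding weakly_reversible_def
proof (intro ballI impI)
  interpret ring R by fact
  fix a b r
  assume [simp]: "a \<in> carrier R" "b \<in> carrier R" "r \<in> carrier R"
    and ab: "a \<otimes>\<^bsub>R\<^esub> b = \<zero>\<^bsub>R\<^esub>"
  \<comment> \<open>With \<open>r\<close> to the left of \<open>a\<close> the product stays zero,
    and swapping the block ra with \<open>b\<close> leaves \<open>r\<close> between \<open>b\<close>
    and \<open>a\<close>.\<close>
  have "(r \<otimes>\<^bsub>R\<^esub> a) \<otimes>\<^bsub>R\<^esub> b \<otimes>\<^bsub>R\<^esub> \<one>\<^bsub>R\<^esub> = \<zero>\<^bsub>R\<^esub>"
    by (simp add: m_assoc ab)
  then have "b \<otimes>\<^bsub>R\<^esub> (r \<otimes>\<^bsub>R\<^esub> a) \<otimes>\<^bsub>R\<^esub> \<one>\<^bsub>R\<^esub> \<in> prime_radical R"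
    using assms(2) unfolding P_symmetric_def by (meson \<open>a \<in> carrier R\<close> \<open>b \<in> carrier R\<close> \<open>r \<in> carrier R\<close> m_closed one_closed)
  then have "b \<otimes>\<^bsub>R\<^esub> r \<otimes>\<^bsub>R\<^esub> a \<in> prime_radical R"
    by (simp add: m_assoc)
  then have "nilpotent_element R u" if "u \<in> carrier R #>\<^bsub>R\<^esub> (b \<otimes>\<^bsub>R\<^esub> r \<otimes>\<^bsub>R\<^esub> a)" for u
    using that by (auto simp: r_coset_def intro: prime_radical_nil prime_radical_mult_left)
  then show "nil_left_ideal (carrier R #>\<^bsub>R\<^esub> (b \<otimes>\<^bsub>R\<^esub> r \<otimes>\<^bsub>R\<^esub> a)) R"
    by (simp add: nil_left_ideal_def left_ideal_r_coset)
qed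

end
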